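(* Let $\mathbf{k}$ be a unitary commutative ring, $\lambda\in\mathbf{k}$, and let $R$ be a $\mathbf{k}$-algebra with a decreasing sequence of ideals $R=I_0\supseteq I_1\supseteq I_2\supseteq\cdots$ with respect to which $R$ is complete, i.e. the canonical map $R\to\varprojlim R/I_n$ is an isomorphism. If $P$ is a Reynolds operator of weight $\lambda$ on $R$ such that $P(I_n)\subseteq I_{n+1}$ for all $n\ge0$, then for all $u,v\in R$, $$P(u)P(v)=\sum_{n=0}^\infty\lambda^nP^{n+1}(u\ast v),\qquad\text{where } u\ast v:=uP(v)+P(u)v,$$ the series converging in the topology on $R$ defined by the ideals $I_n$.
   Context: Algebras are unitary associative $\mathbf{k}$-algebras. A Reynolds operator of weight $\lambda$ on $R$ is a $\mathbf{k}$-linear map $P:R\to R$ with $P(u)P(v)=P(uP(v))+P(P(u)v)+\lambda P(P(u)P(v))$ for all $u,v\in R$. $P^{n}$ denotes the $n$-fold composition of $P$. *)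

theory Defs
  imports "HOL-Algebra.Algebra" "HOL-Analysis.Function_Topology" "HOL-Analysis.Abstract_Limits"
begin

(* The locale algebra of HOL-Algebra demands commutative multiplication; the algebras here are
   only associative and unital. *)
locale assoc_unital_algebra = Module.module K R + A?: Ring.ring R for K (structure) and R (structure) +
  assumes smult_mult_left:
      "\<lbrakk>a \<in> carrier K; x \<in> carrier R; y \<in> carrier R\<rbrakk> \<Longrightarrow>
        (a \<odot>\<^bsub>R\<^esub> x) \<otimes>\<^bsub>R\<^esub> y = a \<odot>\<^bsub>R\<^esub> (x \<otimes>\<^bsub>R\<^esub> y)"
    and smult_mult_right:
      "\<lbrakk>a \<in> carrier K; x \<in> carrier R; y \<in> carrier R\<rbrakk> \<Longrightarrow>
        x \<otimes>\<^bsub>R\<^esub> (a \<odot>\<^bsub>R\<^esub> y) = a \<odot>\<^bsub>R\<^esub> (x \<otimes>\<^bsub>R\<^esub> y)"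

definition linear_endo ::
    "('a, 'm) ring_scheme \<Rightarrow> ('a, 'b, 'n) module_scheme \<Rightarrow> ('b \<Rightarrow> 'b) \<Rightarrow> bool" where
  "linear_endo K R P \<longleftrightarrow>
     P \<in> carrier R \<rightarrow> carrier R \<and>
     (\<forall>x\<in>carrier R. \<forall>y\<in>carrier R. P (x \<oplus>\<^bsub>R\<^esub> y) = P x \<oplus>\<^bsub>R\<^esub> P y) \<and>
     (\<forall>a\<in>carrier K. \<forall>x\<in>carrier R. P (a \<odot>\<^bsub>R\<^esub> x) = a \<odot>\<^bsub>R\<^esub> P x)"

definition reynolds_operator ::
    "('a, 'm) ring_scheme \<Rightarrow> ('a, 'b, 'n) module_scheme \<Rightarrow> 'a \<Rightarrow> ('b \<Rightarrow> 'b) \<Rightarrow> bool" where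
  "reynolds_operator K R lam P \<longleftrightarrow>
     linear_endo K R P \<and>
     (\<forall>u\<in>carrier R. \<forall>v\<in>carrier R.
        P u \<otimes>\<^bsub>R\<^esub> P v =
          P (u \<otimes>\<^bsub>R\<^esub> P v) \<oplus>\<^bsub>R\<^esub> P (P u \<otimes>\<^bsub>R\<^esub> v) \<oplus>\<^bsub>R\<^esub> lam \<odot>\<^bsub>R\<^esub> P (P u \<otimes>\<^bsub>R\<^esub> P v))"

(* Ideals of HOL-Algebra are two-sided. They are automatically closed under scalars in a unital
   algebra, as a \<odot> x = (a \<odot> \<one>) \<otimes> x. *)
definition ideal_filtration :: "('b, 'n) ring_scheme \<Rightarrow> (nat \<Rightarrow> 'b set) \<Rightarrow> bool" where
  "ideal_filtration R I \<longleftrightarrow>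
     (\<forall>n. ideal (I n) R) \<and> I 0 = carrier R \<and> (\<forall>n. I (Suc n) \<subseteq> I n)"

(* For m \<le> n the transition map from R/I n to R/I m sends the coset X = I n + x to
   I m + x, which is the sum I m + X of sets since I n \<subseteq> I m. *)
definition inverse_limit :: "('b, 'n) ring_scheme \<Rightarrow> (nat \<Rightarrow> 'b set) \<Rightarrow> (nat \<Rightarrow> 'b set) ring" where
  "inverse_limit R I =
     \<lparr>partial_object.carrier = {s. (\<forall>n. s n \<in> carrier (R Quot I n)) \<and> (\<forall>m n. m \<le> n \<longrightarrow> I m <+>\<^bsub>R\<^esub> s n = s m)},
      monoid.mult = (\<lambda>s t n. s n \<otimes>\<^bsub>R Quot I n\<^esub> t n),
      monoid.one = (\<lambda>n. \<one>\<^bsub>R Quot I n\<^esub>),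
      ring.zero = (\<lambda>n. \<zero>\<^bsub>R Quot I n\<^esub>),
      ring.add = (\<lambda>s t n. s n \<oplus>\<^bsub>R Quot I n\<^esub> t n)\<rparr>"

(* The canonical map is compatible with scalars, so being an isomorphism of rings and being an
   isomorphism of algebras are the same condition on it. *)
definition complete_wrt :: "('b, 'n) ring_scheme \<Rightarrow> (nat \<Rightarrow> 'b set) \<Rightarrow> bool" where
  "complete_wrt R I \<longleftrightarrow> (\<lambda>x n. I n +>\<^bsub>R\<^esub> x) \<in> ring_iso R (inverse_limit R I)"

definition ideal_topology :: "('b, 'n) ring_scheme \<Rightarrow> (nat \<Rightarrow> 'b set) \<Rightarrow> 'b topology" where
  "ideal_topology R I = topology_generated_by {I n +>\<^bsub>R\<^esub> x | n x. x \<in> carrier R}"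

definition series_sums ::
    "('b, 'n) ring_scheme \<Rightarrow> (nat \<Rightarrow> 'b set) \<Rightarrow> (nat \<Rightarrow> 'b) \<Rightarrow> 'b \<Rightarrow> bool" where
  "series_sums R I f s \<longleftrightarrow>
     limitin (ideal_topology R I) (\<lambda>N. finsum R f {..<N}) s sequentially"

(* As with suminf, the value is meaningful only if the series has exactly one limit. *)
definition series_sum :: "('b, 'n) ring_scheme \<Rightarrow> (nat \<Rightarrow> 'b set) \<Rightarrow> (nat \<Rightarrow> 'b) \<Rightarrow> 'b" where
  "series_sum R I f = (THE s. series_sums R I f s)"

definition reynolds_star :: "('b, 'n) ring_scheme \<Rightarrow> ('b \<Rightarrow> 'b) \<Rightarrow> 'b \<Rightarrow> 'b \<Rightarrow> 'b" where
  "reynolds_star R P u v = (u \<otimes>\<^bsub>R\<^esub> P v) \<oplus>\<^bsub>R\<^esub> (P u \<otimes>\<^bsub>R\<^esub> v)"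

end

theory Submission
  imports Defs
begin

text \<open>
  The Reynolds identity says that \<open>w = P u \<otimes> P v\<close> solves the affine fixed point equation
  \<open>w = P (u \<star> v) \<oplus> \<lambda> P w\<close>. Iterating it \<open>N\<close> times exhibits \<open>w\<close> as the \<open>N\<close>-th partial sum of the
  series plus the remainder \<open>\<lambda>\<^sup>N P\<^sup>N w\<close>, which lies in \<open>I N\<close>. The limit is
  unique because injectivity of the canonical map makes the ideal topology Hausdorff.
\<close>

lemma ideal_filtration_antimono:
  assumes "ideal_filtration R I" "m \<le> n"
  shows "I n \<subseteq> I m"
  by (rule lift_Suc_antimono_le[of I]) (use assms in \<open>simp_all add: ideal_filtration_def\<close>)

text \<open>A scalar acts as multiplication by \<open>a \<odot> \<one>\<close>, which an ideal
  absorbs. This keeps the remainder in \<open>I N\<close> after scaling by the \<open>N\<close>-th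
  power of \<open>lam\<close>.\<close>

lemma (in assoc_unital_algebra) ideal_smult_closed:
  assumes "ideal J R" "a \<in> carrier K" "x \<in> J"
  shows "a \<odot>\<^bsub>R\<^esub> x \<in> J"
proof -
  interpret J: ideal J R by fact
  have x: "x \<in> carrier R" using assms(3) by (rule J.a_Hcarr)
  have "a \<odot>\<^bsub>R\<^esub> x = (a \<odot>\<^bsub>R\<^esub> \<one>\<^bsub>R\<^esub>) \<otimes>\<^bsub>R\<^esub> x"
    using smult_mult_left[of a "\<one>\<^bsub>R\<^esub>" x] assms(2) x by simp
  then show ?thesis using J.I_l_closed[OF assms(3)] assms(2) by simp
qed

lemma (in assoc_unital_algebra) linear_endo_funpow:
  assumes "linear_endo K R P"
  shows "linear_endo K R (P ^^ n)"
  using assms by (induction n) (auto simp: linear_endo_def Pi_iff)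

lemma openin_ideal_topology_coset:
  assumes "x \<in> carrier R"
  shows "openin (ideal_topology R I) (I n +>\<^bsub>R\<^esub> x)"
  unfolding ideal_topology_def by (rule topology_generated_by_Basis) (use assms in blast)

text \<open>Gives access to the coset lemmas of \<open>abelian_subgroup\<close>, which are used
  throughout below.\<close>

lemma (in ideal) ideal_abelian_subgroup: "abelian_subgroup I R"
  using additive_subgroup_axioms is_abelian_group by (rule abelian_subgroupI3)

lemma (in ring) mem_coset_self:
  assumes "ideal J R" "x \<in> carrier R"
  shows "x \<in> J +> x"
  using assms by (intro abelian_subgroup.a_rcos_self ideal.ideal_abelian_subgroup)

lemma (in ring) topspace_ideal_topology:
  assumes "ideal_filtration R I"
  shows "topspace (ideal_topology R I) = carrier R"
proof -
  have I: "ideal (I n) R" for n using assms by (simp add: ideal_filtration_def)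
  have "I n +> x \<subseteq> carrier R" if "x \<in> carrier R" for n x
    by (rule a_r_coset_subset_G[OF additive_subgroup.a_subset[OF ideal.axioms(1)[OF I]] that])
  moreover have "x \<in> I 0 +> x" if "x \<in> carrier R" for x
    using mem_coset_self[OF I that] .
  ultimately show ?thesis
    unfolding ideal_topology_def topology_generated_by_topspace by blast
qed

text \<open>The topology is only given by generators, so the proof is by induction on how
  \<open>U\<close> is generated. Together with openness of cosets, this makes the cosets of
  \<open>x\<close> a neighbourhood base at \<open>x\<close>.\<close>

lemma (in ring) coset_neighbourhood:
  assumes filt: "ideal_filtration R I"
    and U: "openin (ideal_topology R I) U" and "x \<in> U"
  shows "\<exists>n. I n +> x \<subseteq> U"
proof -
  have I: "ideal (I n) R" for n using filt by (simp add: ideal_filtration_def)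
  have "generate_topology_on {I n +> x | n x. x \<in> carrier R} U"
    using U unfolding ideal_topology_def by (rule openin_topology_generated_by)
  then show ?thesis using \<open>x \<in> U\<close>
  proof (induction arbitrary: x)
    case (Int A B)
    then obtain m n where mn: "I m +> x \<subseteq> A" "I n +> x \<subseteq> B" by blast
    \<comment> \<open>The filtration decreases, so the larger index gives a coset contained in both
      others.\<close>
    have "I (max m n) +> x \<subseteq> I k +> x" if "k \<in> {m, n}" for k
      unfolding a_r_coset_def'
      by (rule UN_mono[OF ideal_filtration_antimono[OF filt]]) (use that in auto)
    with mn show ?case by blast
  next
    case (UN \<A>)
    then show ?case by (meson Sup_upper UnionE order_trans)
  next
    case (Basis A)
    then obtain n y where A: "A = I n +> y" "y \<in> carrier R" by blast
    interpret J: ideal "I n" R by (rule I)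
    \<comment> \<open>Any element of a coset represents it, so the generator \<open>A\<close> can be
      recentred at \<open>x\<close>.\<close>
    have "A = I n +> x"
      unfolding A(1)
      by (rule abelian_subgroup.a_repr_independence'[OF J.ideal_abelian_subgroup])
        (use A Basis in simp_all)
    then show ?case by blast
  qed simp
qed

text \<open>At each level \<open>n\<close> some partial sum lies in the cosets of both limits, so
  these cosets coincide. Hence \<open>s\<close> and \<open>t\<close> have the same image under the
  canonical map, which is injective by completeness.\<close>

lemma (in ring) series_sums_unique:
  assumes filt: "ideal_filtration R I" and compl: "complete_wrt R I"
    and s: "series_sums R I f s" and t: "series_sums R I f t"
  shows "s = t"
proof -
  have I: "ideal (I n) R" for n using filt by (simp add: ideal_filtration_def)
  have carr: "s \<in> carrier R" "t \<in> carrier R"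
    using s t topspace_ideal_topology[OF filt] by (auto simp: series_sums_def limitin_def)
  have "I n +> s = I n +> t" for n
  proof -
    interpret J: ideal "I n" R by (rule I)
    have "\<forall>\<^sub>F N in sequentially. finsum R f {..<N} \<in> I n +> r"
      if "series_sums R I f r" "r \<in> carrier R" for r
    proof -
      have "openin (ideal_topology R I) (I n +> r)"
        using that(2) by (rule openin_ideal_topology_coset)
      moreover have "r \<in> I n +> r"
        using I that(2) by (rule mem_coset_self)
      ultimately show ?thesis
        using that(1) by (simp add: series_sums_def limitin_def)
    qed
    \<comment> \<open>Both properties hold for all large \<open>N\<close>, hence for a common
      one.\<close>
    from eventually_conj[OF this[OF s carr(1)] this[OF t carr(2)]]
    obtain N where N: "finsum R f {..<N} \<in> I n +> s" "finsum R f {..<N} \<in> I n +> t"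
      using eventually_happens'[OF sequentially_bot] by blast
    note repr = abelian_subgroup.a_repr_independence'[OF J.ideal_abelian_subgroup]
    show ?thesis
      by (rule trans[OF repr[OF N(1) carr(1)] repr[OF N(2) carr(2), symmetric]])
  qed
  then have eq: "(\<lambda>x n. I n +> x) s = (\<lambda>x n. I n +> x) t"
    by (intro ext)
  have "inj_on (\<lambda>x n. I n +> x) (carrier R)"
    using compl unfolding complete_wrt_def ring_iso_def bij_betw_def by blast
  from inj_onD[OF this eq carr] show ?thesis .
qed

text \<open>For \<open>N \<ge> n\<close> the remainder \<open>r N\<close> lies in
  \<open>I n\<close>, so the partial sum is congruent to \<open>w\<close> modulo \<open>I n\<close>.
  Every neighbourhood of \<open>w\<close> contains such a coset.\<close>

lemma (in ring) series_sumsI: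
  assumes filt: "ideal_filtration R I" and w: "w \<in> carrier R"
    and S: "\<And>N. finsum R f {..<N} \<in> carrier R"
    and r: "\<And>N. r N \<in> I N" and eq: "\<And>N. w = finsum R f {..<N} \<oplus> r N"
  shows "series_sums R I f w"
  unfolding series_sums_def limitin_def
proof (intro conjI allI impI)
  have I: "ideal (I n) R" for n using filt by (simp add: ideal_filtration_def)
  show "w \<in> topspace (ideal_topology R I)" using topspace_ideal_topology[OF filt] w by simp
  fix U assume "openin (ideal_topology R I) U \<and> w \<in> U"
  then obtain n where n: "I n +> w \<subseteq> U" using coset_neighbourhood[OF filt] by blast
  interpret J: ideal "I n" R by (rule I)
  have "finsum R f {..<N} \<in> I n +> w" if "n \<le> N" for N
  proof -
    have rN: "r N \<in> I n" using ideal_filtration_antimono[OF filt that] r by blast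
    then have rc: "r N \<in> carrier R" by (rule J.a_Hcarr)
    have "w = r N \<oplus> finsum R f {..<N}"
      by (rule trans[OF eq a_comm[OF S rc]])
    then have "finsum R f {..<N} = \<ominus> r N \<oplus> w"
      by (simp only: r_neg1[OF rc S])
    moreover have "\<ominus> r N \<in> I n"
      using rN by (rule additive_subgroup.a_inv_closed[OF J.additive_subgroup_axioms])
    ultimately show ?thesis unfolding a_r_coset_def' by blast
  qed
  then show "\<forall>\<^sub>F N in sequentially. finsum R f {..<N} \<in> U"
    using n by (auto simp: eventually_sequentially)
qed

text \<open>Inserting the fixed point equation into the remainder at stage \<open>N\<close> splits
  off the summand of index \<open>N\<close> and leaves the remainder at stage
  \<open>N + 1\<close>.\<close>

lemma (in assoc_unital_algebra) reynolds_iterate: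
  assumes lam: "lam \<in> carrier K" and P: "linear_endo K R P"
    and s: "s \<in> carrier R" and w: "w \<in> carrier R"
    and fixpoint: "w = P s \<oplus>\<^bsub>R\<^esub> lam \<odot>\<^bsub>R\<^esub> P w"
  shows "w = (\<Oplus>\<^bsub>R\<^esub>n\<in>{..<N}. (lam [^]\<^bsub>K\<^esub> n) \<odot>\<^bsub>R\<^esub> (P ^^ (n + 1)) s)
           \<oplus>\<^bsub>R\<^esub> (lam [^]\<^bsub>K\<^esub> N) \<odot>\<^bsub>R\<^esub> (P ^^ N) w"
proof (induction N)
  case 0
  show ?case using w by simp
next
  case (Suc N)
  let ?f = "\<lambda>n. (lam [^]\<^bsub>K\<^esub> n) \<odot>\<^bsub>R\<^esub> (P ^^ (n + 1)) s"
  have lin: "linear_endo K R (P ^^ n)" for n by (rule linear_endo_funpow[OF P])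
  have c [simp]: "(P ^^ n) x \<in> carrier R" if "x \<in> carrier R" for n x
    using lin[of n] that by (auto simp: linear_endo_def)
  have c1 [simp]: "P x \<in> carrier R" if "x \<in> carrier R" for x
    using P that by (auto simp: linear_endo_def)
  have pow: "lam [^]\<^bsub>K\<^esub> n \<in> carrier K" for n :: nat using lam by simp
  have f: "?f n \<in> carrier R" for n using pow c[OF s] by (intro smult_closed)
  \<comment> \<open>Linearity of \<open>P ^^ N\<close> carries the fixed point equation through;
    scaling by the \<open>N\<close>-th power of \<open>lam\<close> follows.\<close>
  have "(P ^^ N) w = (P ^^ N) (P s) \<oplus>\<^bsub>R\<^esub> lam \<odot>\<^bsub>R\<^esub> (P ^^ N) (P w)"
    using lin[of N] s w lam arg_cong[OF fixpoint, of "P ^^ N"]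
    by (simp add: linear_endo_def del: funpow.simps)
  also have "\<dots> = (P ^^ (N + 1)) s \<oplus>\<^bsub>R\<^esub> lam \<odot>\<^bsub>R\<^esub> (P ^^ Suc N) w"
    by (simp add: funpow_swap1)
  finally have "(lam [^]\<^bsub>K\<^esub> N) \<odot>\<^bsub>R\<^esub> (P ^^ N) w
      = ?f N \<oplus>\<^bsub>R\<^esub> (lam [^]\<^bsub>K\<^esub> N) \<odot>\<^bsub>R\<^esub> (lam \<odot>\<^bsub>R\<^esub> (P ^^ Suc N) w)"
    using smult_r_distr[OF pow[of N] c[OF s, of "N + 1"] smult_closed[OF lam c[OF w, of "Suc N"]]]
    by simp
  also have "(lam [^]\<^bsub>K\<^esub> N) \<odot>\<^bsub>R\<^esub> (lam \<odot>\<^bsub>R\<^esub> (P ^^ Suc N) w)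
      = (lam [^]\<^bsub>K\<^esub> Suc N) \<odot>\<^bsub>R\<^esub> (P ^^ Suc N) w"
    using smult_assoc1[OF pow[of N] lam c[OF w, of "Suc N"]] by simp
  finally have step: "(lam [^]\<^bsub>K\<^esub> N) \<odot>\<^bsub>R\<^esub> (P ^^ N) w
      = ?f N \<oplus>\<^bsub>R\<^esub> (lam [^]\<^bsub>K\<^esub> Suc N) \<odot>\<^bsub>R\<^esub> (P ^^ Suc N) w" .
  have sum: "finsum R ?f {..<Suc N} = finsum R ?f {..<N} \<oplus>\<^bsub>R\<^esub> ?f N"
    unfolding lessThan_Suc
    by (subst M.finsum_insert) (use f in \<open>auto simp: M.a_comm\<close>)
  have "w = finsum R ?f {..<N} \<oplus>\<^bsub>R\<^esub> (lam [^]\<^bsub>K\<^esub> N) \<odot>\<^bsub>R\<^esub> (P ^^ N) w"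
    by (rule Suc.IH)
  also have "\<dots> = finsum R ?f {..<Suc N} \<oplus>\<^bsub>R\<^esub> (lam [^]\<^bsub>K\<^esub> Suc N) \<odot>\<^bsub>R\<^esub> (P ^^ Suc N) w"
    unfolding step sum
    by (rule M.a_assoc[symmetric])
      (use f pow lam c[OF w] in \<open>auto simp del: funpow.simps nat_pow_Suc intro!: M.finsum_closed smult_closed\<close>)
  finally show ?case .
qed

theorem proposition2p12:
  fixes K :: "('a, 'm) ring_scheme" and R :: "('a, 'b, 'n) module_scheme"
    and lam :: 'a and I :: "nat \<Rightarrow> 'b set" and P :: "'b \<Rightarrow> 'b" and u v :: 'b
  assumes "assoc_unital_algebra K R"
    and "lam \<in> carrier K"
    and "ideal_filtration R I"
    and "complete_wrt R I"
    and "reynolds_operator K R lam P"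
    and "\<And>n. P ` I n \<subseteq> I (Suc n)"
    and "u \<in> carrier R" and "v \<in> carrier R"
  shows "let f = (\<lambda>n::nat. (lam [^]\<^bsub>K\<^esub> n) \<odot>\<^bsub>R\<^esub> (P ^^ (n + 1)) (reynolds_star R P u v))
         in (\<exists>s. series_sums R I f s) \<and> P u \<otimes>\<^bsub>R\<^esub> P v = series_sum R I f"
proof -
  interpret assoc_unital_algebra K R by fact
  define s where "s = reynolds_star R P u v"
  define w where "w = P u \<otimes>\<^bsub>R\<^esub> P v"
  define f where "f = (\<lambda>n::nat. (lam [^]\<^bsub>K\<^esub> n) \<odot>\<^bsub>R\<^esub> (P ^^ (n + 1)) s)"
  have P: "linear_endo K R P" using assms(5) by (simp add: reynolds_operator_def)
  have Pc: "P x \<in> carrier R" if "x \<in> carrier R" for x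
    using P that by (auto simp: linear_endo_def)
  have s: "s \<in> carrier R" and w: "w \<in> carrier R"
    using assms(7,8) Pc by (simp_all add: s_def w_def reynolds_star_def)
  \<comment> \<open>Additivity of \<open>P\<close> merges the first two terms of the Reynolds
    identity into \<open>P s\<close>, which turns that identity into an equation for
    \<open>w\<close> alone.\<close>
  have "P s = P (u \<otimes>\<^bsub>R\<^esub> P v) \<oplus>\<^bsub>R\<^esub> P (P u \<otimes>\<^bsub>R\<^esub> v)"
    using P Pc assms(7,8) by (simp add: s_def reynolds_star_def linear_endo_def)
  moreover have "w = P (u \<otimes>\<^bsub>R\<^esub> P v) \<oplus>\<^bsub>R\<^esub> P (P u \<otimes>\<^bsub>R\<^esub> v) \<oplus>\<^bsub>R\<^esub> lam \<odot>\<^bsub>R\<^esub> P w"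
    using assms(5,7,8) unfolding reynolds_operator_def w_def by blast
  ultimately have fixpoint: "w = P s \<oplus>\<^bsub>R\<^esub> lam \<odot>\<^bsub>R\<^esub> P w"
    by (simp only:)
  \<comment> \<open>The start is \<open>I 0 = carrier R\<close>, and each application of
    \<open>P\<close> gains one level of the filtration.\<close>
  have PN: "(P ^^ N) w \<in> I N" for N
  proof (induction N)
    case 0
    show ?case using w assms(3) by (simp add: ideal_filtration_def)
  next
    case (Suc N)
    then show ?case using assms(6)[of N] by auto
  qed
  have fc: "f n \<in> carrier R" for n
    using linear_endo_funpow[OF P, of "n + 1"] s assms(2)
    by (auto simp: f_def linear_endo_def simp del: funpow.simps intro!: smult_closed)
  have sums: "series_sums R I f w"
  proof (rule A.series_sumsI[OF assms(3) w])
    show "finsum R f {..<N} \<in> carrier R" for N using fc by (auto intro: M.finsum_closed)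
    show "(lam [^]\<^bsub>K\<^esub> N) \<odot>\<^bsub>R\<^esub> (P ^^ N) w \<in> I N" for N
      using ideal_smult_closed[OF _ _ PN[of N]] assms(2,3) by (simp add: ideal_filtration_def)
    show "w = finsum R f {..<N} \<oplus>\<^bsub>R\<^esub> (lam [^]\<^bsub>K\<^esub> N) \<odot>\<^bsub>R\<^esub> (P ^^ N) w" for N
      unfolding f_def by (rule reynolds_iterate[OF assms(2) P s w fixpoint])
  qed
  \<comment> \<open>Uniqueness of the limit is what lets the definite description in
    \<open>series_sum\<close> evaluate to \<open>w\<close>.\<close>
  then have "series_sum R I f = w"
    unfolding series_sum_def
    using A.series_sums_unique[OF assms(3,4)] by blast
  with sums show ?thesis unfolding Let_def f_def s_def w_def by auto
qed

end
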